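(* Let $(X,b)$ be a connected weighted graph satisfying a global Poincaré inequality, i.e. there is $c>0$ with $\|f\|_{\mathcal V}^2\le c\,\mathcal E(f)$ for all $f\in\mathcal D$, and let $c_P$ be the smallest constant for which this inequality holds for all $f\in\mathcal D$. Then $$c_P=\mathrm{diam}_r(X)=\|j\|^2,$$ where $\|j\|$ is the operator norm of the embedding $j:(\mathcal D/\mathrm{lin}\{1\},\|\cdot\|_{\mathcal E})\to(\ell^\infty(X)/\mathrm{lin}\{1\},\|\cdot\|_{\mathcal V})$.
   Context: A weighted graph $(X,b)$ consists of a nonempty countable (finite or infinite) set $X$ and a symmetric function $b:X\times X\to[0,\infty)$ with $b(x,x)=0$ for all $x\in X$ (no summability or local finiteness is assumed). It is connected if for any $x,y\in X$ there are $x=x_0,x_1,\dots,x_k=y$ with $b(x_j,x_{j+1})>0$ for $0\le j<k$. Let $\mathcal D=\{f:X\to\mathbb R\mid \sum_{x,y\in X}b(x,y)|f(x)-f(y)|^2<\infty\}$ and $\mathcal E(f)=\frac12\sum_{x,y\in X}b(x,y)(f(x)-f(y))^2$ for $f\in\mathcal D$. For $f:X\to\mathbb R$ put $\|f\|_{\mathcal V}=\sup f-\inf f\in[0,\infty]$. $\ell^\infty(X)$ is the space of bounded real functions on $X$, $\mathrm{lin}\{1\}$ the space of constant functions. On the quotients, $\|f+\mathrm{lin}\{1\}\|_{\mathcal E}=\mathcal E(f)^{1/2}$ and $\|f+\mathrm{lin}\{1\}\|_{\mathcal V}=\|f\|_{\mathcal V}$. The map $j$ is $f+\mathrm{lin}\{1\}\mapsto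 f+\mathrm{lin}\{1\}$ (the Poincaré inequality gives $\mathcal D\subset\ell^\infty(X)$). For $x,y\in X$, $r(x,y)$ is the smallest number with $|f(x)-f(y)|^2\le r(x,y)\,\mathcal E(f)$ for all $f\in\mathcal D$; equivalently $r(x,y)=\sup\{|f(x)-f(y)|^2\mid f\in\mathcal D,\ \mathcal E(f)\le1\}$. $\mathrm{diam}_r(X)=\sup_{x,y\in X}r(x,y)$. *)

theory Defs
  imports "HOL-Analysis.Analysis"
begin

text \<open>
  The vertex set \<open>X\<close> is the type \<^typ>\<open>'v::countable\<close> (nonempty, finite or countably infinite).
  Quantities that range over \<open>[0,\<infinity>]\<close> are of type \<^typ>\<open>ennreal\<close>; in particular a smallest constant
  is a least element of \<open>[0,\<infinity>]\<close>, so no negative constants interfere when \<open>X\<close> is a single point.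
\<close>

definition weighted_graph :: "('v::countable \<Rightarrow> 'v \<Rightarrow> real) \<Rightarrow> bool" where
  "weighted_graph b \<longleftrightarrow> (\<forall>x y. 0 \<le> b x y) \<and> (\<forall>x y. b x y = b y x) \<and> (\<forall>x. b x x = 0)"

definition connected_graph :: "('v::countable \<Rightarrow> 'v \<Rightarrow> real) \<Rightarrow> bool" where
  "connected_graph b \<longleftrightarrow> (\<forall>x y. (\<lambda>u v. b u v > 0)\<^sup>*\<^sup>* x y)"


subsection \<open>Energy and variation\<close>

definition finite_energy :: "('v::countable \<Rightarrow> 'v \<Rightarrow> real) \<Rightarrow> ('v \<Rightarrow> real) set" where
  "finite_energy b = {f. (\<lambda>(x, y). b x y * \<bar>f x - f y\<bar>\<^sup>2) summable_on UNIV}"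

definition energy :: "('v::countable \<Rightarrow> 'v \<Rightarrow> real) \<Rightarrow> ('v \<Rightarrow> real) \<Rightarrow> real" where
  "energy b f = (1 / 2) * (\<Sum>\<^sub>\<infinity>(x, y)\<in>UNIV. b x y * (f x - f y)\<^sup>2)"

text \<open>The difference never has the form \<open>\<infinity> - \<infinity>\<close>, since the supremum exceeds \<open>-\<infinity>\<close> and the infimum is
  below \<open>\<infinity>\<close>; it is nonnegative, so \<^const>\<open>e2ennreal\<close> does not truncate.\<close>

definition variation_norm :: "('v::countable \<Rightarrow> real) \<Rightarrow> ennreal" where
  "variation_norm f = e2ennreal ((SUP x. ereal (f x)) - (INF x. ereal (f x)))"

definition poincare_inequality :: "('v::countable \<Rightarrow> 'v \<Rightarrow> real) \<Rightarrow> ennreal \<Rightarrow> bool" where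
  "poincare_inequality b c \<longleftrightarrow>
     (\<forall>f\<in>finite_energy b. (variation_norm f)\<^sup>2 \<le> c * ennreal (energy b f))"

definition poincare_constant :: "('v::countable \<Rightarrow> 'v \<Rightarrow> real) \<Rightarrow> ennreal" where
  "poincare_constant b = (LEAST c. poincare_inequality b c)"


subsection \<open>Resistance metric\<close>

definition resistance :: "('v::countable \<Rightarrow> 'v \<Rightarrow> real) \<Rightarrow> 'v \<Rightarrow> 'v \<Rightarrow> ennreal" where
  "resistance b x y =
     (LEAST r. \<forall>f\<in>finite_energy b. ennreal (\<bar>f x - f y\<bar>\<^sup>2) \<le> r * ennreal (energy b f))"

definition resistance_diameter :: "('v::countable \<Rightarrow> 'v \<Rightarrow> real) \<Rightarrow> ennreal" where
  "resistance_diameter b = (SUP x. SUP y. resistance b x y)"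


subsection \<open>Quotients by the constant functions and the embedding\<close>

definition bounded_functions :: "('v::countable \<Rightarrow> real) set" where
  "bounded_functions = {f. bounded (range f)}"

definition const_functions :: "('v::countable \<Rightarrow> real) set" where
  "const_functions = {g. \<exists>c. g = (\<lambda>x. c)}"

definition coset :: "('v::countable \<Rightarrow> real) \<Rightarrow> ('v \<Rightarrow> real) set" where
  "coset f = (\<lambda>g x. f x + g x) ` const_functions"

definition quotient_const :: "('v::countable \<Rightarrow> real) set \<Rightarrow> ('v \<Rightarrow> real) set set" where
  "quotient_const V = coset ` V"

text \<open>A map \<open>\<phi>\<close> that does not depend on the representative induces the map \<open>F \<mapsto> the_elem (\<phi> ` F)\<close>
  on cosets; see the lemmas \<open>energy_norm_coset\<close>, \<open>quotient_variation_norm_coset\<close> and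
  \<open>embedding_coset\<close>.\<close>

definition energy_norm :: "('v::countable \<Rightarrow> 'v \<Rightarrow> real) \<Rightarrow> ('v \<Rightarrow> real) set \<Rightarrow> real" where
  "energy_norm b F = the_elem ((\<lambda>f. sqrt (energy b f)) ` F)"

definition quotient_variation_norm :: "('v::countable \<Rightarrow> real) set \<Rightarrow> ennreal" where
  "quotient_variation_norm F = the_elem (variation_norm ` F)"

definition embedding :: "('v::countable \<Rightarrow> real) set \<Rightarrow> ('v \<Rightarrow> real) set" where
  "embedding F = the_elem (coset ` F)"

definition operator_norm :: "'a set \<Rightarrow> ('a \<Rightarrow> real) \<Rightarrow> ('b \<Rightarrow> ennreal) \<Rightarrow> ('a \<Rightarrow> 'b) \<Rightarrow> ennreal" where
  "operator_norm V n m T = (SUP v\<in>{v \<in> V. n v \<le> 1}. m (T v))"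

definition embedding_norm :: "('v::countable \<Rightarrow> 'v \<Rightarrow> real) \<Rightarrow> ennreal" where
  "embedding_norm b =
     operator_norm (quotient_const (finite_energy b)) (energy_norm b)
       quotient_variation_norm embedding"


subsection \<open>Well-definedness\<close>

lemma coset_alt: "coset f = (\<lambda>c x. f x + c) ` UNIV"
  unfolding coset_def const_functions_def by (auto simp: image_iff)

lemma the_elem_coset:
  assumes "\<And>c. \<phi> (\<lambda>x. f x + c) = \<phi> f"
  shows "the_elem (\<phi> ` coset f) = \<phi> f"
proof -
  have "\<phi> ` coset f = {\<phi> f}"
    unfolding coset_alt by (auto simp: assms image_iff)
  then show ?thesis by simp
qed

lemma energy_norm_coset: "energy_norm b (coset f) = sqrt (energy b f)"
  unfolding energy_norm_def by (rule the_elem_coset) (simp add: energy_def)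

lemma variation_norm_shift: "variation_norm (\<lambda>x. f x + c) = variation_norm f"
proof -
  have S: "(SUP x. ereal (f x + c)) = (SUP x. ereal (f x)) + ereal c"
    using SUP_ereal_add_left[of UNIV "ereal c" "\<lambda>x. ereal (f x)"] by simp
  have le: "(INF x. ereal (g x)) + ereal d \<le> (INF x. ereal (g x + d))" for g :: "'a \<Rightarrow> real" and d
  proof (rule INF_greatest)
    fix y
    have "(INF x. ereal (g x)) + ereal d \<le> ereal (g y) + ereal d"
      by (intro add_right_mono INF_lower) simp
    then show "(INF x. ereal (g x)) + ereal d \<le> ereal (g y + d)" by simp
  qed
  have "(INF x. ereal (f x + c)) + ereal (- c) \<le> (INF x. ereal (f x))"
    using le[of "\<lambda>x. f x + c" "- c"] by simp
  then have I: "(INF x. ereal (f x + c)) = (INF x. ereal (f x)) + ereal c"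
    using le[of f c]
    by (cases "INF x. ereal (f x)"; cases "INF x. ereal (f x + c)") auto
  show ?thesis
    unfolding variation_norm_def S I
    by (cases "SUP x. ereal (f x)"; cases "INF x. ereal (f x)") auto
qed

lemma quotient_variation_norm_coset: "quotient_variation_norm (coset f) = variation_norm f"
  unfolding quotient_variation_norm_def by (rule the_elem_coset) (rule variation_norm_shift)

lemma coset_shift: "coset (\<lambda>x. f x + c) = coset f"
proof -
  have "(\<lambda>x. f x + d) \<in> coset (\<lambda>x. f x + c)" for d
    unfolding coset_alt by (rule image_eqI[of _ _ "d - c"]) auto
  moreover have "(\<lambda>x. f x + c + d) \<in> coset f" for d
    unfolding coset_alt by (rule image_eqI[of _ _ "c + d"]) auto
  ultimately show ?thesis
    unfolding coset_alt[of f] coset_alt[of "\<lambda>x. f x + c"] by blast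
qed

lemma embedding_coset: "embedding (coset f) = coset f"
  unfolding embedding_def by (rule the_elem_coset) (rule coset_shift)

lemma energy_nonneg: "weighted_graph b \<Longrightarrow> 0 \<le> energy b f"
  unfolding energy_def weighted_graph_def
  by (auto intro!: infsum_nonneg)

lemma ennreal_least_multiplier:
  fixes a :: "'i \<Rightarrow> ennreal" and e :: "'i \<Rightarrow> real"
  assumes "\<forall>i\<in>A. a i \<le> c * ennreal (e i)"
  shows "\<forall>i\<in>A. a i \<le> (LEAST c. \<forall>i\<in>A. a i \<le> c * ennreal (e i)) * ennreal (e i)"
proof -
  define S where "S = {c. \<forall>i\<in>A. a i \<le> c * ennreal (e i)}"
  have P: "\<forall>i\<in>A. a i \<le> Inf S * ennreal (e i)"
  proof
    fix i assume i: "i \<in> A"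
    show "a i \<le> Inf S * ennreal (e i)"
    proof (cases "ennreal (e i) = 0")
      case True
      with assms i show ?thesis by force
    next
      case False
      have "a i / ennreal (e i) \<le> Inf S"
        unfolding S_def using i False
        by (intro Inf_greatest) (auto intro!: divide_le_posI_ennreal simp: mult.commute zero_less_iff_neq_zero)
      then have "a i / ennreal (e i) * ennreal (e i) \<le> Inf S * ennreal (e i)"
        by (rule mult_right_mono) simp
      also have "a i / ennreal (e i) * ennreal (e i) = a i"
        using False by (simp add: ennreal_divide_times ennreal_times_divide mult_divide_eq_ennreal)
      finally show ?thesis .
    qed
  qed
  have "(LEAST c. \<forall>i\<in>A. a i \<le> c * ennreal (e i)) = Inf S"
    by (rule Least_equality) (use P in \<open>auto simp: S_def intro: Inf_lower\<close>)
  with P show ?thesis by simp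
qed

lemma poincare_constant_attained:
  "poincare_inequality b c \<Longrightarrow> poincare_inequality b (poincare_constant b)"
  unfolding poincare_inequality_def poincare_constant_def by (rule ennreal_least_multiplier)

lemma finite_energy_summable:
  "f \<in> finite_energy b \<Longrightarrow> (\<lambda>p. b (fst p) (snd p) * (f (fst p) - f (snd p))\<^sup>2) summable_on UNIV"
  by (simp add: finite_energy_def case_prod_unfold)

lemma energy_zero_imp_const:
  assumes "weighted_graph b" "connected_graph b" "f \<in> finite_energy b" "energy b f = 0"
  shows "f x = f y"
proof -
  have *: "b u v * (f u - f v)\<^sup>2 = 0" for u v
  proof -
    let ?h = "\<lambda>p. b (fst p) (snd p) * (f (fst p) - f (snd p))\<^sup>2"
    have "infsum ?h UNIV \<le> 0" using assms(4) by (simp add: energy_def case_prod_unfold)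
    moreover have "?h p \<ge> 0" for p using assms(1) by (simp add: weighted_graph_def)
    ultimately have "?h (u, v) = 0"
      using nonneg_infsum_le_0D[of ?h UNIV "(u, v)"] finite_energy_summable[OF assms(3)] by simp
    then show ?thesis by simp
  qed
  have "(\<lambda>u v. b u v > 0)\<^sup>*\<^sup>* x y" using assms(2) by (simp add: connected_graph_def)
  then show ?thesis
  proof induction
    case (step u v)
    then show ?case using *[of u v] by simp
  qed simp
qed

lemma finite_energy_scale:
  assumes "f \<in> finite_energy b"
  shows "(\<lambda>x. t * f x) \<in> finite_energy b" "energy b (\<lambda>x. t * f x) = t\<^sup>2 * energy b f"
proof -
  have eq: "b u v * (t * f u - t * f v)\<^sup>2 = t\<^sup>2 * (b u v * (f u - f v)\<^sup>2)" for u v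
    by (simp add: power2_eq_square algebra_simps)
  show "(\<lambda>x. t * f x) \<in> finite_energy b"
    using summable_on_cmult_right[OF finite_energy_summable[OF assms], of "t\<^sup>2"]
    by (simp add: finite_energy_def case_prod_unfold eq)
  show "energy b (\<lambda>x. t * f x) = t\<^sup>2 * energy b f"
    by (simp add: energy_def case_prod_unfold eq infsum_cmult_right')
qed

lemma const_finite_energy: "(\<lambda>x. c) \<in> finite_energy b" "energy b (\<lambda>x. c) = 0"
  by (simp_all add: finite_energy_def energy_def case_prod_unfold)

lemma resistance_SUP:
  assumes "weighted_graph b" "connected_graph b"
  shows "resistance b x y =
    (SUP f\<in>{f \<in> finite_energy b. energy b f \<le> 1}. ennreal (\<bar>f x - f y\<bar>\<^sup>2))" (is "_ = ?R")
  unfolding resistance_def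
proof (rule Least_equality)
  show "\<forall>f\<in>finite_energy b. ennreal (\<bar>f x - f y\<bar>\<^sup>2) \<le> ?R * ennreal (energy b f)"
  proof
    fix f assume f: "f \<in> finite_energy b"
    show "ennreal (\<bar>f x - f y\<bar>\<^sup>2) \<le> ?R * ennreal (energy b f)"
    proof (cases "energy b f = 0")
      case True
      then show ?thesis using energy_zero_imp_const[OF assms f True, of x y] by simp
    next
      case False
      then have E: "energy b f > 0" using energy_nonneg[OF assms(1), of f] by linarith
      define t where "t = 1 / sqrt (energy b f)"
      have t: "t\<^sup>2 = 1 / energy b f" using E by (simp add: t_def power_divide)
      have "ennreal (\<bar>t * f x - t * f y\<bar>\<^sup>2) \<le> ?R"
        using finite_energy_scale[OF f, of t] t E by (intro SUP_upper) auto
      then have "ennreal (\<bar>t * f x - t * f y\<bar>\<^sup>2) * ennreal (energy b f) \<le> ?R * ennreal (energy b f)"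
        by (rule mult_right_mono) simp
      also have "ennreal (\<bar>t * f x - t * f y\<bar>\<^sup>2) * ennreal (energy b f)
          = ennreal ((t\<^sup>2 * energy b f) * (f x - f y)\<^sup>2)"
      proof -
        have "(t * f x - t * f y)\<^sup>2 * energy b f = (t\<^sup>2 * energy b f) * (f x - f y)\<^sup>2"
          by (simp add: power2_eq_square algebra_simps)
        then show ?thesis using E by (metis ennreal_mult less_imp_le power2_abs zero_le_power2)
      qed
      finally show ?thesis using t E by simp
    qed
  qed
next
  fix r assume r: "\<forall>f\<in>finite_energy b. ennreal (\<bar>f x - f y\<bar>\<^sup>2) \<le> r * ennreal (energy b f)"
  show "?R \<le> r"
  proof (rule SUP_least)
    fix f assume "f \<in> {f \<in> finite_energy b. energy b f \<le> 1}"
    then have f: "f \<in> finite_energy b" "energy b f \<le> 1" by auto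
    have "ennreal (\<bar>f x - f y\<bar>\<^sup>2) \<le> r * ennreal (energy b f)" using r f by blast
    also have "\<dots> \<le> r * 1" using f by (intro mult_left_mono) (auto simp: ennreal_le_1)
    finally show "ennreal (\<bar>f x - f y\<bar>\<^sup>2) \<le> r" by simp
  qed
qed

lemma abs_diff_le_variation_norm: "ennreal \<bar>f x - f y\<bar> \<le> variation_norm f"
proof -
  have *: "ennreal (f u - f v) \<le> variation_norm f" for u v
  proof -
    have "ereal (f u) \<le> (SUP x. ereal (f x))" by (rule SUP_upper) simp
    moreover have "(INF x. ereal (f x)) \<le> ereal (f v)" by (rule INF_lower) simp
    ultimately have "ereal (f u) - ereal (f v) \<le> (SUP x. ereal (f x)) - (INF x. ereal (f x))"
      by (rule ereal_minus_mono)
    then have "e2ennreal (ereal (f u - f v)) \<le> variation_norm f"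
      unfolding variation_norm_def by (intro e2ennreal_mono) simp
    then show ?thesis by simp
  qed
  show ?thesis using *[of x y] *[of y x] by (auto simp: abs_if)
qed

lemma finite_energy_bounded:
  assumes "poincare_inequality b c" "c \<noteq> \<infinity>"
  shows "finite_energy b \<subseteq> bounded_functions"
proof
  fix f assume "f \<in> finite_energy b"
  with assms have "(variation_norm f)\<^sup>2 \<le> c * ennreal (energy b f)"
    by (auto simp: poincare_inequality_def)
  also have "\<dots> < \<infinity>" using assms(2) by (simp add: ennreal_mult_less_top less_top)
  finally have "variation_norm f < \<infinity>" by (auto simp: power2_eq_square ennreal_mult_less_top)
  then obtain B where B: "variation_norm f = ennreal B" "0 \<le> B" by (cases "variation_norm f") auto
  have "\<bar>f x - f undefined\<bar> \<le> B" for x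
    using abs_diff_le_variation_norm[of f x undefined] B by simp
  moreover have "\<bar>f x\<bar> \<le> \<bar>f x - f undefined\<bar> + \<bar>f undefined\<bar>" for x by simp
  ultimately have "\<bar>f x\<bar> \<le> B + \<bar>f undefined\<bar>" for x
    by (meson add_right_mono order_trans)
  then show "f \<in> bounded_functions"
    unfolding bounded_functions_def bounded_iff by auto
qed

lemma embedding_maps_to:
  assumes "poincare_inequality b c" "c \<noteq> \<infinity>"
  shows "embedding \<in> quotient_const (finite_energy b) \<rightarrow> quotient_const bounded_functions"
  using finite_energy_bounded[OF assms] unfolding quotient_const_def
  by (auto simp: embedding_coset)

end

theory Submission
  imports Defs
begin

text \<open>Both \<open>\<parallel>f\<parallel>\<^sub>\<V> = sup\<^bsub>x,y\<^esub> \<bar>f x - f y\<bar>\<close> and the resistance metric are suprema, so interchanging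
  the suprema over pairs \<open>(x, y)\<close> and over the unit ball of the energy gives the claim.\<close>

lemma ennreal_power2_le_iff: "x\<^sup>2 \<le> y\<^sup>2 \<longleftrightarrow> x \<le> y" for x y :: ennreal
proof
  assume le: "x\<^sup>2 \<le> y\<^sup>2"
  show "x \<le> y"
  proof (cases y)
    case (real s)
    \<comment> \<open>A finite \<open>y\<close> forces \<open>x\<close> to be finite, so the
      comparison can be made between real squares.\<close>
    have "x\<^sup>2 < top"
      using le by (rule le_less_trans) (simp add: real ennreal_power)
    then have "x \<noteq> top" by (auto simp: power2_eq_square)
    then obtain r where r: "x = ennreal r" "0 \<le> r" by (cases x) auto
    have "r\<^sup>2 \<le> s\<^sup>2"
      using le real r by (simp add: ennreal_power)
    then have "r \<le> s" using real(1) by (rule power2_le_imp_le)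
    then show ?thesis unfolding real(2) r(1) by (rule ennreal_leI)
  qed simp
qed (rule power_mono, simp_all)

text \<open>Lets any bound in [0, \<infinity>] be written as a square, so that estimates between
  squares reduce to estimates between their bases.\<close>

lemma ennreal_power2_surj: "\<exists>s. K = s\<^sup>2" for K :: ennreal
proof (cases K)
  case (real k)
  then have "K = (ennreal (sqrt k))\<^sup>2" by (simp add: ennreal_power)
  then show ?thesis ..
next
  case top
  then have "K = top\<^sup>2" by (simp add: power2_eq_square)
  then show ?thesis ..
qed

text \<open>Squaring is an order automorphism of [0, \<infinity>], being onto and order-reflecting,
  and such a map preserves all suprema.\<close>

lemma ennreal_SUP_power2: "(SUP i\<in>I. a i)\<^sup>2 = (SUP i\<in>I. (a i)\<^sup>2)" for a :: "'i \<Rightarrow> ennreal"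
proof (rule antisym)
  obtain s where s: "(SUP i\<in>I. (a i)\<^sup>2) = s\<^sup>2" using ennreal_power2_surj by blast
  have "a i \<le> s" if "i \<in> I" for i
    using SUP_upper[OF that, of "\<lambda>i. (a i)\<^sup>2"] by (simp add: s ennreal_power2_le_iff)
  then show "(SUP i\<in>I. a i)\<^sup>2 \<le> (SUP i\<in>I. (a i)\<^sup>2)"
    by (simp add: s ennreal_power2_le_iff SUP_le_iff)
  show "(SUP i\<in>I. (a i)\<^sup>2) \<le> (SUP i\<in>I. a i)\<^sup>2"
    by (intro SUP_least power_mono SUP_upper) simp_all
qed

lemma variation_norm_SUP: "variation_norm f = (SUP x. SUP y. ennreal \<bar>f x - f y\<bar>)" (is "_ = ?M")
proof (rule antisym)
  show "variation_norm f \<le> ?M"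
  proof (cases ?M)
    case (real B)
    have "ennreal \<bar>f x - f y\<bar> \<le> ennreal B" for x y
      unfolding real(2)[symmetric] by (meson SUP_upper2 UNIV_I order_refl)
    with real(1) have B: "\<bar>f x - f y\<bar> \<le> B" for x y by simp
    \<comment> \<open>The bound \<open>f x \<le> f y + B\<close> is first maximised over
      \<open>x\<close>, then minimised over \<open>y\<close>.\<close>
    have "(SUP x. ereal (f x)) - ereal B \<le> (INF y. ereal (f y))"
    proof (rule INF_greatest)
      fix y
      have "(SUP x. ereal (f x)) \<le> ereal (f y + B)"
        using B[of _ y] by (intro SUP_least) (simp add: abs_le_iff algebra_simps)
      then show "(SUP x. ereal (f x)) - ereal B \<le> ereal (f y)"
        by (cases "SUP x. ereal (f x)") auto
    qed
    \<comment> \<open>A single value of \<open>f\<close> lies between infimum and supremum. This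
      keeps the infimum below \<infinity> and the supremum above -\<infinity>, so the terms of the
      extended-real inequality can be rearranged.\<close>
    moreover have "(INF x. ereal (f x)) \<le> ereal (f undefined)" by (rule INF_lower) simp
    moreover have "ereal (f undefined) \<le> (SUP x. ereal (f x))" by (rule SUP_upper) simp
    ultimately have "(SUP x. ereal (f x)) - (INF x. ereal (f x)) \<le> ereal B"
      by (cases "SUP x. ereal (f x)"; cases "INF x. ereal (f x)") auto
    then have "variation_norm f \<le> e2ennreal (ereal B)"
      unfolding variation_norm_def by (rule e2ennreal_mono)
    then show ?thesis using real by simp
  next
    case top
    show ?thesis unfolding top by (rule top_greatest)
  qed
qed (intro SUP_least abs_diff_le_variation_norm)

lemma variation_norm_power2: "(variation_norm f)\<^sup>2 = (SUP x. SUP y. ennreal (\<bar>f x - f y\<bar>\<^sup>2))"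
  by (simp only: variation_norm_SUP ennreal_SUP_power2 ennreal_power abs_ge_zero)

text \<open>The squared variation is a supremum over pairs, so \<open>c\<close> is a Poincare
  constant exactly when it bounds the squared differences of every pair, that is, when it dominates
  every resistance.\<close>

lemma poincare_inequality_iff_resistance_diameter:
  assumes "weighted_graph b" "connected_graph b" "poincare_inequality b c\<^sub>0"
  shows "poincare_inequality b c \<longleftrightarrow> resistance_diameter b \<le> c"
proof -
  have pointwise: "poincare_inequality b c \<longleftrightarrow>
      (\<forall>x y. \<forall>f\<in>finite_energy b. ennreal (\<bar>f x - f y\<bar>\<^sup>2) \<le> c * ennreal (energy b f))" for c
    unfolding poincare_inequality_def variation_norm_power2 SUP_le_iff by blast
  \<comment> \<open>\<open>c\<^sub>0\<close> is an admissible multiplier for each pair, so the least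
    multiplier is attained and \<open>resistance b x y\<close> satisfies its own defining
    inequality.\<close>
  have "ennreal (\<bar>f x - f y\<bar>\<^sup>2) \<le> resistance b x y * ennreal (energy b f)"
    if "f \<in> finite_energy b" for f x y
    using ennreal_least_multiplier[of "finite_energy b" "\<lambda>f. ennreal (\<bar>f x - f y\<bar>\<^sup>2)" c\<^sub>0 "energy b"]
      assms(3) that unfolding resistance_def pointwise by blast
  moreover have "resistance b x y \<le> c"
    if "\<forall>f\<in>finite_energy b. ennreal (\<bar>f x - f y\<bar>\<^sup>2) \<le> c * ennreal (energy b f)" for x y
    unfolding resistance_SUP[OF assms(1,2)]
  proof (rule SUP_least)
    fix f assume f: "f \<in> {f \<in> finite_energy b. energy b f \<le> 1}"
    then have "ennreal (\<bar>f x - f y\<bar>\<^sup>2) \<le> c * ennreal (energy b f)" using that by blast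
    also have "\<dots> \<le> c * 1" using f by (intro mult_left_mono) (auto simp: ennreal_le_1)
    finally show "ennreal (\<bar>f x - f y\<bar>\<^sup>2) \<le> c" by simp
  qed
  ultimately show ?thesis
    unfolding pointwise resistance_diameter_def SUP_le_iff
    by (meson UNIV_I mult_right_mono order_trans zero_le)
qed

text \<open>The energy norm of a coset is the square root of the energy of any representative, so
  the unit ball of the quotient is the image of the energy unit ball under
  \<open>coset\<close>.\<close>

lemma embedding_norm_eq_SUP:
  "embedding_norm b = (SUP f\<in>{f \<in> finite_energy b. energy b f \<le> 1}. variation_norm f)"
proof -
  have "{F \<in> quotient_const (finite_energy b). energy_norm b F \<le> 1}
      = coset ` {f \<in> finite_energy b. energy b f \<le> 1}"
    by (auto simp: quotient_const_def energy_norm_coset)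
  then show ?thesis
    by (simp add: embedding_norm_def operator_norm_def image_image embedding_coset
        quotient_variation_norm_coset)
qed

lemma resistance_diameter_eq_embedding_norm:
  assumes "weighted_graph b" "connected_graph b"
  shows "resistance_diameter b = (embedding_norm b)\<^sup>2"
proof -
  let ?B = "{f \<in> finite_energy b. energy b f \<le> 1}"
  have "resistance_diameter b = (SUP x. SUP y. SUP f\<in>?B. ennreal (\<bar>f x - f y\<bar>\<^sup>2))"
    by (simp only: resistance_diameter_def resistance_SUP[OF assms])
  also have "\<dots> = (SUP f\<in>?B. SUP x. SUP y. ennreal (\<bar>f x - f y\<bar>\<^sup>2))"
    \<comment> \<open>Fixing \<open>A\<close> directs both rewrites at the right-hand side, where
      the supremum over the ball moves inward past \<open>x\<close> and then past
      \<open>y\<close>.\<close>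
    by (subst SUP_commute[where A = ?B], subst SUP_commute[where A = ?B], rule refl)
  also have "\<dots> = (embedding_norm b)\<^sup>2"
    by (simp only: embedding_norm_eq_SUP ennreal_SUP_power2 variation_norm_power2)
  finally show ?thesis .
qed

theorem proposition3p4:
  fixes b :: "'v::countable \<Rightarrow> 'v \<Rightarrow> real"
  assumes "weighted_graph b"
    and "connected_graph b"
    and "\<exists>c::real. c > 0 \<and> poincare_inequality b (ennreal c)"
  shows "poincare_constant b = resistance_diameter b
       \<and> resistance_diameter b = (embedding_norm b)\<^sup>2"
proof
  from assms(3) obtain c :: real where c: "poincare_inequality b (ennreal c)" by blast
  show "poincare_constant b = resistance_diameter b"
    \<comment> \<open>The admissible constants form the ray above
      \<open>resistance_diameter b\<close>, whose least element is its endpoint.\<close>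
    unfolding poincare_constant_def poincare_inequality_iff_resistance_diameter[OF assms(1,2) c]
    by (rule Least_equality) auto
  show "resistance_diameter b = (embedding_norm b)\<^sup>2"
    using assms(1,2) by (rule resistance_diameter_eq_embedding_norm)
qed

end
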